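(* Let $\mathcal V:=\{(x,y)\in[0,1]^2:\ \max\{(1-3x)/2,\,2x-1\}\le y\le \max\{1-x,x\}\}$. For each integer $Q\ge 3$ let $\mathscr D_Q$ be the set of pairs $(q_1,q_2)$ of denominators of consecutive elements $a_1/q_1<a_2/q_2$ of $\mathfrak{SF}_Q$ (fractions in lowest terms), and let $\mathscr D:=\bigcup_{Q\ge 3} Q^{-1}\mathscr D_Q\subseteq\mathbb R^2$. Then $\mathscr D$ is dense in $\mathcal V$: $\mathscr D\subseteq \mathcal V$ and the closure of $\mathscr D$ contains $\mathcal V$.
   Context: For a reduced fraction $a/q\in\mathbb Q\cap(0,1]$ with $q\ge 2$, let $\bar a$ denote the multiplicative inverse of $a$ modulo $q$ in $[1,q)$, and set $h(a/q):=q+a+\bar a$; for $a/q=1/1$ set $h(1/1):=3$. The set of $\mathrm{SL}(2,\mathbb N)$-saturated Farey fractions of level $Q\ge3$ is $\mathfrak{SF}_Q:=\{a/q\in\mathbb Q\cap(0,1]: h(a/q)\le Q\}$, and "consecutive elements" refers to neighbors when $\mathfrak{SF}_Q$ is listed in increasing order. *)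

theory Defs
  imports "HOL-Analysis.Analysis" "HOL-Number_Theory.Modular_Inverse"
begin

definition numerator :: "rat \<Rightarrow> int" where
  "numerator r = fst (quotient_of r)"

definition denominator :: "rat \<Rightarrow> int" where
  "denominator r = snd (quotient_of r)"

(* For q \<ge> 2 and a coprime to q, modular_inverse q a lies in {1..<q}; modulo 1 the library
   value is 0, so the fraction 1/1 is treated separately. Only used on (0,1]. *)
definition height :: "rat \<Rightarrow> int" where
  "height r =
    (if r = 1 then 3
     else denominator r + numerator r + modular_inverse (denominator r) (numerator r))"

definition SF :: "int \<Rightarrow> rat set" where
  "SF Q = {r. 0 < r \<and> r \<le> 1 \<and> height r \<le> Q}"

definition consecutive_in :: "'a::linorder set \<Rightarrow> 'a \<Rightarrow> 'a \<Rightarrow> bool" where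
  "consecutive_in A x y \<longleftrightarrow> x \<in> A \<and> y \<in> A \<and> x < y \<and> \<not> (\<exists>z\<in>A. x < z \<and> z < y)"

definition denominator_pairs :: "int \<Rightarrow> (int \<times> int) set" where
  "denominator_pairs Q =
    {(denominator r1, denominator r2) | r1 r2. consecutive_in (SF Q) r1 r2}"

definition scaled_denominator_pairs :: "(real \<times> real) set" where
  "scaled_denominator_pairs =
    (\<Union>Q\<in>{3..}. (\<lambda>(q1, q2). (of_int q1 / of_int Q, of_int q2 / of_int Q)) ` denominator_pairs Q)"

definition region_V :: "(real \<times> real) set" where
  "region_V = {(x, y). 0 \<le> x \<and> x \<le> 1 \<and> 0 \<le> y \<and> y \<le> 1 \<and>
     max ((1 - 3 * x) / 2) (2 * x - 1) \<le> y \<and> y \<le> max (1 - x) x}"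

end

theory Submission
  imports Defs
begin

text \<open>The height of \<open>a / q\<close> is \<open>q + a + c\<close> with \<open>c\<close> the denominator of the left parent in the
  Stern--Brocot tree, so it increases along the tree and \<open>SF Q\<close> is a subtree. Hence of two
  consecutive fractions one is a parent of the other, their determinant is 1, and consecutiveness
  means that both heights are at most \<open>Q\<close> while the height \<open>2 q1 + q2 + a1 + a2\<close> of the mediant
  exceeds \<open>Q\<close>. With \<open>x = q1 / Q\<close>, \<open>y = q2 / Q\<close> and a common slope \<open>t\<close> of both fractions, these
  conditions become \<open>2x + y + t(x + y) > 1\<close> and, according as \<open>x \<le> y\<close> or \<open>y \<le> x\<close>,
  \<open>x + y + ty \<le> 1\<close> or \<open>2x - y + tx \<le> 1\<close>; some \<open>t\<close> between 0 and 1 satisfies them exactly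
  over the region, up to its boundary. Density follows because integer matrices of
  determinant 1 can be found whose entries approach any prescribed \<open>(x, y, tx, ty)\<close>
  after scaling.\<close>

section \<open>Left Stern--Brocot parents and heights of fractions\<close>

lemma coprime_of_det_one:
  fixes a q c k :: int
  assumes "a * c - q * k = 1"
  shows "coprime a q"
proof (rule coprimeI)
  fix d assume "d dvd a" "d dvd q"
  then have "d dvd a * c - q * k" by (simp add: dvd_diff)
  then show "is_unit d" using assms by simp
qed

lemma quotient_of_Fract_coprime:
  assumes "coprime a q" "q > 0"
  shows "quotient_of (Fract a q) = (a, q)"
  using assms by (simp add: quotient_of_Fract normalize_stable)

lemma Fract_less_iff:
  assumes "b > 0" "d > 0"
  shows "Fract a b < Fract c d \<longleftrightarrow> a * d < c * b"
  using assms by (simp add: less_rat)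

declare less_rat [simp del]

text \<open>The number \<open>c\<close> is the denominator of the left Stern--Brocot parent \<open>k / c\<close> of \<open>a / q\<close>;
  at \<open>1 / 1\<close> this parent is \<open>0 / 1\<close>, which accounts for the exceptional value of the height.\<close>

lemma height_Fract_eq:
  fixes a q c k :: int
  assumes "0 < a" "a \<le> q" "1 \<le> c" "c \<le> q" "a * c - q * k = 1"
  shows "height (Fract a q) = q + a + c"
proof (cases "q = 1")
  case True
  then have "a = 1" "c = 1" using assms by auto
  then show ?thesis using True by (simp add: height_def One_rat_def)
next
  case False
  have cop: "coprime a q" using assms(5) by (rule coprime_of_det_one)
  have "a \<noteq> q" using cop False assms by auto
  then have "Fract a q \<noteq> 1" using assms by (simp add: One_rat_def eq_rat)
  moreover have "modular_inverse q a = c"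
  proof (rule modular_inverse_int_eqI)
    have "c \<noteq> q"
    proof
      assume "c = q"
      then have "q * (a - k) = 1" using assms(5) by (simp add: algebra_simps)
      then show False using False assms by (simp add: zmult_eq_1_iff)
    qed
    then show "c \<in> {0..<q}" using assms by auto
    have "a * c = 1 + q * k" using assms by simp
    then show "[a * c = 1] (mod q)" by (simp add: cong_def)
  qed
  ultimately show ?thesis using assms cop
    by (simp add: height_def denominator_def numerator_def quotient_of_Fract_coprime)
qed

lemma left_parent_exists:
  fixes a q :: int
  assumes "0 < a" "a \<le> q" "coprime a q"
  obtains c k where "1 \<le> c" "c \<le> q" "0 \<le> k" "k < a" "a * c - q * k = 1"
proof (cases "q = 1")
  case True
  then show ?thesis using assms that[of 1 0] by auto
next
  case False
  let ?c = "modular_inverse q a"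
  have "[a * ?c = 1] (mod q)" using assms cong_modular_inverse1 by blast
  then have "q dvd a * ?c - 1" by (simp add: cong_iff_dvd_diff)
  then obtain k where k: "a * ?c - 1 = q * k" by (elim dvdE)
  have "0 \<le> ?c" "?c < q"
    using assms False modular_inverse_int_nonneg[of q a] modular_inverse_int_less[of q a] by auto
  moreover have "0 < ?c" using assms False mult_modular_inverse_int_pos[of q a] by auto
  ultimately have c: "1 \<le> ?c" "?c < q" by auto
  have "a * ?c \<ge> 1" using c assms by (smt (verit) mult_le_cancel_left1 mult_pos_pos)
  then have "0 \<le> q * k" using k by simp
  then have "0 \<le> k" using assms by (simp add: zero_le_mult_iff)
  moreover have "q * k < q * a" using k c assms
    by (smt (verit) mult.commute mult_less_cancel_left_pos)
  then have "k < a" using assms by simp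
  ultimately show ?thesis using that[of ?c k] c k by auto
qed

text \<open>The denominator of the left parent is the least positive inverse of \<open>a\<close>
  modulo \<open>q\<close>, so any positive inverse \<open>c\<close>, even one above
  \<open>q\<close>, bounds the height. This serves inverses read off a determinant without
  reduction.\<close>

lemma height_Fract_le:
  fixes a q c k :: int
  assumes "0 < a" "a \<le> q" "1 \<le> c" "a * c - q * k = 1"
  shows "height (Fract a q) \<le> q + a + c"
proof -
  have cop: "coprime a q" using assms(4) by (rule coprime_of_det_one)
  obtain c' k' where c': "1 \<le> c'" "c' \<le> q" "a * c' - q * k' = 1"
    using left_parent_exists[OF assms(1,2) cop] by blast
  have h: "height (Fract a q) = q + a + c'" using height_Fract_eq[OF assms(1,2) c'] .
  have "c' \<le> c"
  proof (rule ccontr)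
    assume n: "\<not> c' \<le> c"
    have "a * (c' - c) = q * (k' - k)" using c' assms by (simp add: algebra_simps)
    then have "q dvd a * (c' - c)" by simp
    then have "q dvd c' - c" using cop
      by (simp add: coprime_commute coprime_dvd_mult_right_iff)
    then have "q \<le> c' - c" using n by (simp add: zdvd_imp_le)
    then show False using c' assms by simp
  qed
  then show ?thesis using h by simp
qed

section \<open>Necessary conditions on consecutive fractions\<close>

lemma Fract_mem_SF_iff:
  assumes "q > 0"
  shows "Fract a q \<in> SF Q \<longleftrightarrow> 0 < a \<and> a \<le> q \<and> height (Fract a q) \<le> Q"
  using assms by (simp add: SF_def zero_less_Fract_iff Fract_le_one_iff)

lemma SF_cases:
  assumes "r \<in> SF Q"
  obtains a q c k where "r = Fract a q" "0 < a" "a \<le> q" "coprime a q"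
    "1 \<le> c" "c \<le> q" "0 \<le> k" "k < a" "a * c - q * k = 1" "q + a + c \<le> Q"
proof -
  obtain a q where r: "r = Fract a q" "q > 0" "coprime a q" using Rat_cases by blast
  then have aq: "0 < a" "a \<le> q" "height r \<le> Q" using assms Fract_mem_SF_iff by auto
  obtain c k where ck: "1 \<le> c" "c \<le> q" "0 \<le> k" "k < a" "a * c - q * k = 1"
    using left_parent_exists[OF aq(1,2) r(3)] by blast
  show ?thesis using that[of a q c k] r aq ck height_Fract_eq[OF aq(1,2) ck(1,2,5)] by simp
qed

text \<open>In the unimodular basis \<open>(q1, a1)\<close>, \<open>(q2, a2)\<close> the vector
  \<open>(q, a)\<close> has positive integer coefficients \<open>l\<close> and \<open>m\<close>. No
  sign is required of \<open>a1\<close>, \<open>a2\<close> and \<open>a\<close>, so the bound also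
  applies to rotated vectors.\<close>

lemma mediant_denominator_le:
  fixes a q a1 q1 a2 q2 :: int
  assumes "q1 > 0" "q2 > 0" "q1 * a2 - q2 * a1 = 1" "a1 * q < a * q1" "a * q2 < a2 * q"
  shows "q1 + q2 \<le> q"
proof -
  define l m where "l = a2 * q - a * q2" and "m = a * q1 - a1 * q"
  have "1 \<le> l" "1 \<le> m" using assms by (auto simp: l_def m_def)
  moreover have "l * q1 + m * q2 = q * (q1 * a2 - q2 * a1)"
    by (simp add: l_def m_def algebra_simps)
  then have "q = l * q1 + m * q2" using assms by simp
  moreover have "q1 \<le> l * q1" "q2 \<le> m * q2" using assms \<open>1 \<le> l\<close> \<open>1 \<le> m\<close> by auto
  ultimately show ?thesis by linarith
qed

text \<open>The left parent \<open>?L\<close> of \<open>r2\<close> and the right parent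
  \<open>?R\<close> of \<open>r1\<close> cannot lie in the gap, as their heights would be at most
  \<open>Q\<close>. Either one of them is the other fraction, or both gap ends are strictly
  enclosed, which is impossible.\<close>

lemma consecutive_SF_cases:
  assumes "consecutive_in (SF Q) r1 r2"
  obtains a1 q1 a2 q2 where "denominator r1 = q1" "denominator r2 = q2"
    "0 < a1" "a1 \<le> q1" "0 < a2" "a2 \<le> q2" "q1 + q2 + a1 + a2 + q1 > Q"
    "q1 \<le> q2 \<and> q1 + q2 + a2 \<le> Q \<or> q2 \<le> q1 \<and> 2 * q1 - q2 + a1 \<le> Q"
proof -
  have mem: "r1 \<in> SF Q" "r2 \<in> SF Q" and less: "r1 < r2"
    and gap: "\<And>z. z \<in> SF Q \<Longrightarrow> r1 < z \<Longrightarrow> z < r2 \<Longrightarrow> False"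
    using assms by (auto simp: consecutive_in_def)
  obtain a1 q1 c1 k1 where r1: "r1 = Fract a1 q1" "0 < a1" "a1 \<le> q1" "coprime a1 q1"
    "1 \<le> c1" "c1 \<le> q1" "0 \<le> k1" "k1 < a1" "a1 * c1 - q1 * k1 = 1" "q1 + a1 + c1 \<le> Q"
    using SF_cases[OF mem(1)] .
  obtain a2 q2 c2 k2 where r2: "r2 = Fract a2 q2" "0 < a2" "a2 \<le> q2" "coprime a2 q2"
    "1 \<le> c2" "c2 \<le> q2" "0 \<le> k2" "k2 < a2" "a2 * c2 - q2 * k2 = 1" "q2 + a2 + c2 \<le> Q"
    using SF_cases[OF mem(2)] .
  have d: "denominator r1 = q1" "denominator r2 = q2"
    using r1 r2 by (auto simp: denominator_def quotient_of_Fract_coprime)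
  have pos: "q1 > 0" "q2 > 0" "c2 > 0" using r1 r2 by auto
  have lt: "a1 * q2 < a2 * q1" using less r1 r2 pos by (simp add: Fract_less_iff)
  \<comment> \<open>This makes the denominator of \<open>?R\<close> positive; equality would force
    \<open>r1 = 1\<close>.\<close>
  have "c1 < q1"
  proof (rule ccontr)
    assume "\<not> c1 < q1"
    then have "q1 * (a1 - k1) = 1" using r1 by (simp add: algebra_simps)
    then have "q1 = 1" using pos by (simp add: zmult_eq_1_iff)
    then have "a1 = 1" using r1 by simp
    then show False using lt \<open>q1 = 1\<close> r2 by simp
  qed
  have mediant: "Q < q1 + q2 + a1 + a2 + q1" if det: "q1 * a2 - q2 * a1 = 1"
  proof (rule ccontr)
    assume n: "\<not> Q < q1 + q2 + a1 + a2 + q1"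
    let ?z = "Fract (a1 + a2) (q1 + q2)"
    \<comment> \<open>The left parent of the mediant is \<open>r1\<close>, hence the last summand
      \<open>q1\<close>.\<close>
    have "height ?z = (q1 + q2) + (a1 + a2) + q1"
      using det r1 r2 by (intro height_Fract_eq[where k = a1]) (auto simp: algebra_simps)
    then have "?z \<in> SF Q" using n r1 r2 by (simp add: Fract_mem_SF_iff)
    moreover have "r1 < ?z" "?z < r2"
      using lt r1 r2 pos by (simp_all add: Fract_less_iff algebra_simps)
    ultimately show False using gap by blast
  qed
  have c2k2: "k2 * q2 < a2 * c2" using r2 by (simp add: algebra_simps)
  have copL: "coprime k2 c2"
    using r2(9) by (intro coprime_of_det_one[where c = "- q2" and k = "- a2"]) (simp add: algebra_simps)
  let ?L = "Fract k2 c2" and ?R = "Fract (a1 - k1) (q1 - c1)"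
  have L: "?L \<le> r1"
  proof (rule ccontr)
    assume "\<not> ?L \<le> r1"
    then have L1: "r1 < ?L" by simp
    then have "a1 * c2 < k2 * q1" using r1 pos by (simp add: Fract_less_iff)
    moreover have "0 < a1 * c2" using r1 pos by simp
    \<comment> \<open>The left parent may be 0/1, which is not a candidate for \<open>SF Q\<close>;
      lying above \<open>r1\<close> excludes this.\<close>
    ultimately have "0 < k2" using pos by (smt (verit) zero_less_mult_iff)
    have L2: "?L < r2" using r2 pos c2k2 by (simp add: Fract_less_iff)
    then have "?L < 1" using mem(2) by (auto simp: SF_def)
    then have "k2 < c2" using pos by (simp add: Fract_less_one_iff)
    obtain c k where "1 \<le> c" "c \<le> c2" "k2 * c - c2 * k = 1"
      using left_parent_exists[OF \<open>0 < k2\<close> less_imp_le[OF \<open>k2 < c2\<close>] copL] by metis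
    then have "height ?L \<le> c2 + k2 + c"
      using \<open>0 < k2\<close> \<open>k2 < c2\<close> by (intro height_Fract_le) auto
    then have "?L \<in> SF Q"
      using \<open>0 < k2\<close> \<open>k2 < c2\<close> r2 \<open>c \<le> c2\<close> by (simp add: Fract_mem_SF_iff)
    then show False using gap L1 L2 by blast
  qed
  have detR: "(a1 - k1) * c1 - (q1 - c1) * k1 = 1" using r1 by (simp add: algebra_simps)
  have r1R: "a1 * (q1 - c1) < (a1 - k1) * q1" using r1 by (simp add: algebra_simps)
  have R: "r2 \<le> ?R"
  proof (rule ccontr)
    assume "\<not> r2 \<le> ?R"
    then have R2: "?R < r2" by simp
    have R1: "r1 < ?R" using r1 r1R \<open>c1 < q1\<close> pos by (simp add: Fract_less_iff)
    have "?R < 1" using R2 mem(2) by (auto simp: SF_def)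
    then have "a1 - k1 < q1 - c1" using \<open>c1 < q1\<close> by (simp add: Fract_less_one_iff)
    then have "height ?R \<le> (q1 - c1) + (a1 - k1) + c1"
      using r1 detR by (intro height_Fract_le) auto
    then have "?R \<in> SF Q"
      using \<open>a1 - k1 < q1 - c1\<close> \<open>c1 < q1\<close> r1 by (simp add: Fract_mem_SF_iff)
    then show False using gap R1 R2 by blast
  qed
  consider "?L = r1" | "?R = r2" | "?L < r1" "r2 < ?R" using L R by fastforce
  then show ?thesis
  proof cases
    case 1
    then have "quotient_of (Fract k2 c2) = quotient_of (Fract a1 q1)" using r1 by simp
    then have "k2 = a1" "c2 = q1"
      using copL r1 pos by (auto simp: quotient_of_Fract_coprime)
    then show ?thesis using that[of q1 q2 a1 a2] d mediant r1 r2
      by (simp add: algebra_simps)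
  next
    case 2
    have "coprime (a1 - k1) (q1 - c1)" using detR by (rule coprime_of_det_one)
    moreover have "quotient_of ?R = quotient_of (Fract a2 q2)" using 2 r2 by simp
    ultimately have "a1 - k1 = a2" "q1 - c1 = q2"
      using r2 pos \<open>c1 < q1\<close> by (auto simp: quotient_of_Fract_coprime)
    then have e: "k1 = a1 - a2" "c1 = q1 - q2" by auto
    then have "q1 * a2 - q2 * a1 = 1" using r1(9) unfolding e by (simp add: algebra_simps)
    then show ?thesis using that[of q1 q2 a1 a2] d mediant r1 r2 e by simp
  next
    \<comment> \<open>Now \<open>r1\<close> lies strictly between \<open>?L\<close> and
      \<open>r2\<close>, so \<open>q1 > q2\<close>, while \<open>r2\<close> lies strictly between
      \<open>r1\<close> and \<open>?R\<close>, so \<open>q2 > q1\<close>.\<close>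
    case 3
    have "c2 + q2 \<le> q1"
      using 3 r1 r2 lt pos by (intro mediant_denominator_le[of c2 q2 a2 k2 q1 a1])
        (auto simp: Fract_less_iff algebra_simps)
    moreover have "q1 + (q1 - c1) \<le> q2"
      using 3 r1 r2 lt pos \<open>c1 < q1\<close>
      by (intro mediant_denominator_le[of q1 "q1 - c1" "a1 - k1" a1 q2 a2])
        (auto simp: Fract_less_iff algebra_simps)
    ultimately show ?thesis using pos \<open>c1 < q1\<close> by linarith
  qed
qed

section \<open>Containment in the region\<close>

lemma scaled_denominator_pairs_subset: "scaled_denominator_pairs \<subseteq> region_V"
proof
  fix p assume "p \<in> scaled_denominator_pairs"
  then obtain Q q1 q2 where Q: "3 \<le> Q" and "(q1, q2) \<in> denominator_pairs Q"
    and p: "p = (of_int q1 / of_int Q, of_int q2 / of_int Q)"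
    by (auto simp: scaled_denominator_pairs_def)
  then obtain r1 r2 where con: "consecutive_in (SF Q) r1 r2"
    and q: "denominator r1 = q1" "denominator r2 = q2"
    by (auto simp: denominator_pairs_def)
  obtain a1 a2 where h:
    "0 < a1" "a1 \<le> q1" "0 < a2" "a2 \<le> q2" "q1 + q2 + a1 + a2 + q1 > Q"
    "q1 \<le> q2 \<and> q1 + q2 + a2 \<le> Q \<or> q2 \<le> q1 \<and> 2 * q1 - q2 + a1 \<le> Q"
    using consecutive_SF_cases[OF con] unfolding q by metis
  define x y where "x = real_of_int q1 / Q" and "y = real_of_int q2 / Q"
  have xy: "real_of_int q1 = x * Q" "real_of_int q2 = y * Q"
    using Q by (auto simp: x_def y_def)
  have iff: "0 \<le> u * real_of_int Q \<longleftrightarrow> 0 \<le> u" for u using Q by (simp add: zero_le_mult_iff)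
  have "0 \<le> x" "0 \<le> y" using h Q by (auto simp: x_def y_def)
  \<comment> \<open>Bounding \<open>a1\<close> by \<open>q1\<close> and \<open>a2\<close> by
    \<open>q2\<close> in the mediant inequality gives the lower left edge; dropping the positive
    numerators from the height bounds gives the other edges.\<close>
  moreover have "0 \<le> real_of_int (3 * q1 + 2 * q2 - Q)" using h by simp
  then have "0 \<le> (3 * x + 2 * y - 1) * Q" using xy by (simp add: algebra_simps)
  then have "1 \<le> 3 * x + 2 * y" by (simp only: iff)
  moreover have "x \<le> y \<and> x + y \<le> 1 \<or> y \<le> x \<and> 2 * x - y \<le> 1"
    using h(6)
  proof
    assume A: "q1 \<le> q2 \<and> q1 + q2 + a2 \<le> Q"
    then have "0 \<le> real_of_int (q2 - q1)" "0 \<le> real_of_int (Q - q1 - q2)" using h by auto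
    then have "0 \<le> (y - x) * Q" "0 \<le> (1 - x - y) * Q" using xy by (auto simp: algebra_simps)
    then show ?thesis by (simp only: iff) linarith
  next
    assume A: "q2 \<le> q1 \<and> 2 * q1 - q2 + a1 \<le> Q"
    then have "0 \<le> real_of_int (q1 - q2)" "0 \<le> real_of_int (Q - 2 * q1 + q2)" using h by auto
    then have "0 \<le> (x - y) * Q" "0 \<le> (1 - 2 * x + y) * Q" using xy by (auto simp: algebra_simps)
    then show ?thesis by (simp only: iff) linarith
  qed
  ultimately have "(x, y) \<in> region_V" unfolding region_V_def by auto
  then show "p \<in> region_V" using p by (simp add: x_def y_def)
qed

section \<open>Sufficient conditions for consecutiveness\<close>

lemma consecutive_SF_I:
  fixes a1 q1 a2 q2 :: int
  assumes "0 < a1" "a1 \<le> q1" "0 < a2" "a2 \<le> q2" and det: "q1 * a2 - q2 * a1 = 1"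
    and h: "height (Fract a1 q1) \<le> Q" "height (Fract a2 q2) \<le> Q"
    and mediant: "q1 + q2 + a1 + a2 + q1 > Q"
  shows "consecutive_in (SF Q) (Fract a1 q1) (Fract a2 q2)"
  unfolding consecutive_in_def
proof (intro conjI notI)
  show "Fract a1 q1 \<in> SF Q" "Fract a2 q2 \<in> SF Q"
    using assms by (auto simp: Fract_mem_SF_iff)
  show "Fract a1 q1 < Fract a2 q2" using assms by (simp add: Fract_less_iff algebra_simps)
  assume "\<exists>z\<in>SF Q. Fract a1 q1 < z \<and> z < Fract a2 q2"
  then obtain z where z: "z \<in> SF Q" "Fract a1 q1 < z" "z < Fract a2 q2" by blast
  obtain a q c k where r: "z = Fract a q" "0 < a" "a \<le> q" "coprime a q"
    "1 \<le> c" "c \<le> q" "0 \<le> k" "k < a" "a * c - q * k = 1" "q + a + c \<le> Q"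
    using SF_cases[OF z(1)] .
  have lt: "a1 * q < a * q1" "a * q2 < a2 * q" using z r assms by (auto simp: Fract_less_iff)
  have q: "q1 + q2 \<le> q" using assms lt by (intro mediant_denominator_le[of q1 q2 a2 a1 q a]) auto
  \<comment> \<open>The same bound after the rotation sending \<open>(q, a)\<close> to
    \<open>(a, -q)\<close>. It remains to show \<open>q1 \<le> c\<close>; then the height of
    \<open>z\<close> is at least that of the mediant.\<close>
  have a: "a1 + a2 \<le> a"
    using assms lt r by (intro mediant_denominator_le[of a1 a2 "- q2" "- q1" a "- q"])
      (auto simp: algebra_simps)
  \<comment> \<open>The left parent \<open>k / c\<close> of \<open>z\<close> is not below
    \<open>a1 / q1\<close>: otherwise \<open>a1 / q1\<close> would lie strictly between
    \<open>k / c\<close> and \<open>z\<close> and have a denominator larger than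
    \<open>q\<close>.\<close>
  have e: "c * a1 - k * q1 \<le> 0"
  proof (rule ccontr)
    assume "\<not> c * a1 - k * q1 \<le> 0"
    then have "c + q \<le> q1"
      using lt r by (intro mediant_denominator_le[of c q a k q1 a1]) (auto simp: algebra_simps)
    then show False using q r assms by simp
  qed
  have "q * (c * a2 - k * q2) = c * (q * a2 - a * q2) + q2 * (a * c - q * k)"
    by (simp add: algebra_simps)
  also have "\<dots> > 0" using r lt assms by (intro add_pos_pos mult_pos_pos) (auto simp: mult.commute)
  finally have f: "1 \<le> c * a2 - k * q2" using r by (simp add: zero_less_mult_iff)
  \<comment> \<open>Cramer's rule expresses \<open>c\<close> through \<open>q1\<close> and
    \<open>q2\<close>, with coefficients bounded below by 1 and 0.\<close>
  have "c = c * (q1 * a2 - q2 * a1)" using det by simp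
  also have "\<dots> = q1 * (c * a2 - k * q2) + q2 * (k * q1 - c * a1)" by (simp add: algebra_simps)
  also have "\<dots> \<ge> q1 * 1 + q2 * 0"
    using assms e f by (intro add_mono mult_left_mono) auto
  finally have "q1 \<le> c" by simp
  then show False using q a r mediant by simp
qed

text \<open>Here \<open>a1 / q1\<close> is the left parent of \<open>a2 / q2\<close>, whose height
  is therefore \<open>q1 + q2 + a2\<close>. The other height is at most \<open>2 * q1 + a1\<close>,
  which is smaller.\<close>

lemma consecutive_SF_of_less:
  fixes a1 q1 a2 q2 :: int
  assumes "0 < a1" "a1 \<le> q1" "a2 \<le> q2" and det: "q1 * a2 - q2 * a1 = 1"
    and "q1 < q2" "a1 < a2" "q1 + q2 + a2 \<le> Q" "q1 + q2 + a1 + a2 + q1 > Q"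
  shows "consecutive_in (SF Q) (Fract a1 q1) (Fract a2 q2)"
proof (rule consecutive_SF_I)
  have "height (Fract a2 q2) = q2 + a2 + q1"
    using assms by (intro height_Fract_eq[where k = a1]) (auto simp: algebra_simps)
  then show "height (Fract a2 q2) \<le> Q" using assms by simp
  have "coprime a1 q1"
    using det by (intro coprime_of_det_one[where c = "- q2" and k = "- a2"]) (simp add: algebra_simps)
  then obtain c k where "1 \<le> c" "c \<le> q1" "a1 * c - q1 * k = 1"
    using left_parent_exists[of a1 q1] assms by blast
  then have "height (Fract a1 q1) = q1 + a1 + c" using assms by (intro height_Fract_eq)
  then show "height (Fract a1 q1) \<le> Q" using assms \<open>c \<le> q1\<close> by simp
qed (use assms in auto)

text \<open>Here \<open>a2 / q2\<close> is the right parent of \<open>a1 / q1\<close>, so the left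
  parent has denominator \<open>q1 - q2\<close>. This difference is also an inverse of
  \<open>a2\<close> modulo \<open>q2\<close>, possibly unreduced, which bounds the other
  height.\<close>

lemma consecutive_SF_of_greater:
  fixes a1 q1 a2 q2 :: int
  assumes "0 < a2" "a1 \<le> q1" "a2 \<le> q2" and det: "q1 * a2 - q2 * a1 = 1"
    and "q2 < q1" "a2 < a1" "2 * q1 - q2 + a1 \<le> Q" "q1 + q2 + a1 + a2 + q1 > Q"
  shows "consecutive_in (SF Q) (Fract a1 q1) (Fract a2 q2)"
proof (rule consecutive_SF_I)
  have "height (Fract a1 q1) = q1 + a1 + (q1 - q2)"
    using assms by (intro height_Fract_eq[where k = "a1 - a2"]) (auto simp: algebra_simps)
  then show "height (Fract a1 q1) \<le> Q" using assms by simp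
  have "height (Fract a2 q2) \<le> q2 + a2 + (q1 - q2)"
    using assms by (intro height_Fract_le[where k = "a1 - a2"]) (auto simp: algebra_simps)
  then show "height (Fract a2 q2) \<le> Q" using assms by simp
qed (use assms in auto)

section \<open>Unimodular matrices and rational points of the closure\<close>

lemma quadratic_ratio_tendsto:
  fixes A B C E L :: real
  assumes "E \<noteq> 0" "L = A / E"
  shows "(\<lambda>N. (A * (real N)\<^sup>2 + B * real N + C) / (E * (real N)\<^sup>2)) \<longlonglongrightarrow> L"
proof -
  have "(\<lambda>N. A / E + B / E * inverse (real N) + C / E * (inverse (real N))\<^sup>2)
      \<longlonglongrightarrow> A / E + B / E * 0 + C / E * 0\<^sup>2"
    by (intro tendsto_intros lim_inverse_n)
  moreover have "\<forall>\<^sub>F N in sequentially. A / E + B / E * inverse (real N) + C / E * (inverse (real N))\<^sup>2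
      = (A * (real N)\<^sup>2 + B * real N + C) / (E * (real N)\<^sup>2)"
    using eventually_gt_at_top[of 0]
    by eventually_elim (use assms in \<open>simp add: field_simps power2_eq_square\<close>)
  ultimately have "(\<lambda>N. (A * (real N)\<^sup>2 + B * real N + C) / (E * (real N)\<^sup>2))
      \<longlonglongrightarrow> A / E + B / E * 0 + C / E * 0\<^sup>2"
    by (rule Lim_transform_eventually)
  then show ?thesis using assms(2) by simp
qed

text \<open>The matrix with rows \<open>(q1, a1)\<close> and \<open>(q2, a2)\<close> is the product of the unimodular matrices
  with rows \<open>(i\<^sup>2N, ijN + 1)\<close>, \<open>(ijN - 1, j\<^sup>2N)\<close> and \<open>(n\<^sup>2N, mnN - 1)\<close>, \<open>(mnN + 1, m\<^sup>2N)\<close>.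
  As \<open>N\<close> grows, the columns of the first approach the direction \<open>(i, j)\<close> and the rows of
  the second the direction \<open>(n, m)\<close>.\<close>

lemma unimodular_approximation:
  fixes i j d m n :: int
  assumes "i > 0" "j > 0" "d > 0" "m > 0" "n > 0"
  obtains q1 q2 a1 a2 Q :: "nat \<Rightarrow> int" where
    "\<And>N. q1 N * a2 N - q2 N * a1 N = 1"
    "\<forall>\<^sub>F N in sequentially. 3 \<le> Q N"
    "(\<lambda>N. real_of_int (q1 N) / real_of_int (Q N)) \<longlonglongrightarrow> of_int i / of_int d"
    "(\<lambda>N. real_of_int (q2 N) / real_of_int (Q N)) \<longlonglongrightarrow> of_int j / of_int d"
    "(\<lambda>N. real_of_int (a1 N) / real_of_int (Q N)) \<longlonglongrightarrow> of_int m / of_int n * (of_int i / of_int d)"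
    "(\<lambda>N. real_of_int (a2 N) / real_of_int (Q N)) \<longlonglongrightarrow> of_int m / of_int n * (of_int j / of_int d)"
proof
  \<comment> \<open>\<open>K\<close> is the inner product of \<open>(i, j)\<close> and
    \<open>(n, m)\<close>, a common factor of all leading coefficients of the matrix product;
    dividing by \<open>E\<close> leaves exactly the four prescribed limits.\<close>
  define K where "K = i * n + j * m"
  define E where "E = K * n * d"
  have K: "K > 0" using assms by (simp add: K_def add_pos_pos)
  then have E: "E > 0" using assms by (simp add: E_def)
  let ?q1 = "\<lambda>N::nat. K * i * n * (int N)\<^sup>2 + (i * j + m * n) * int N + 1"
  let ?q2 = "\<lambda>N::nat. K * j * n * (int N)\<^sup>2 + (j\<^sup>2 - n\<^sup>2) * int N + 0"
  let ?a1 = "\<lambda>N::nat. K * i * m * (int N)\<^sup>2 + (m\<^sup>2 - i\<^sup>2) * int N + 0"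
  let ?a2 = "\<lambda>N::nat. K * j * m * (int N)\<^sup>2 + (- (i * j + m * n)) * int N + 1"
  let ?Q = "\<lambda>N::nat. E * (int N)\<^sup>2"
  show "?q1 N * ?a2 N - ?q2 N * ?a1 N = 1" for N
    unfolding K_def by algebra
  show "\<forall>\<^sub>F N in sequentially. 3 \<le> ?Q N"
    using eventually_ge_at_top[of 3]
  proof eventually_elim
    case (elim N)
    have "3 \<le> int N" using elim by simp
    also have "\<dots> \<le> (int N)\<^sup>2" using elim by (simp add: power2_eq_square)
    also have "\<dots> \<le> ?Q N" using E mult_right_mono[of 1 E "(int N)\<^sup>2"] by simp
    finally show ?case .
  qed
  have lim: "(\<lambda>N. real_of_int (A * (int N)\<^sup>2 + B * int N + C) / real_of_int (?Q N)) \<longlonglongrightarrow> L"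
    if "L = real_of_int A / real_of_int E" for A B C L
    using quadratic_ratio_tendsto[of E L A B C] that E by simp
  show "(\<lambda>N. real_of_int (?q1 N) / real_of_int (?Q N)) \<longlonglongrightarrow> of_int i / of_int d"
    by (rule lim) (use K assms in \<open>simp add: E_def\<close>)
  show "(\<lambda>N. real_of_int (?q2 N) / real_of_int (?Q N)) \<longlonglongrightarrow> of_int j / of_int d"
    by (rule lim) (use K assms in \<open>simp add: E_def\<close>)
  show "(\<lambda>N. real_of_int (?a1 N) / real_of_int (?Q N)) \<longlonglongrightarrow> of_int m / of_int n * (of_int i / of_int d)"
    by (rule lim) (use K assms in \<open>simp add: E_def\<close>)
  show "(\<lambda>N. real_of_int (?a2 N) / real_of_int (?Q N)) \<longlonglongrightarrow> of_int m / of_int n * (of_int j / of_int d)"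
    by (rule lim) (use K assms in \<open>simp add: E_def\<close>)
qed

lemma scaled_denominator_pairsI:
  assumes "consecutive_in (SF Q) (Fract a1 q1) (Fract a2 q2)" "3 \<le> Q"
    "q1 * a2 - q2 * a1 = 1" "0 < q1" "0 < q2"
  shows "(of_int q1 / of_int Q, of_int q2 / of_int Q) \<in> scaled_denominator_pairs"
proof -
  have "coprime a1 q1" "coprime a2 q2"
    using assms(3)
    by (auto intro: coprime_of_det_one[where c = "- q2" and k = "- a2"]
        coprime_of_det_one[where c = q1 and k = a1] simp: algebra_simps)
  then have "denominator (Fract a1 q1) = q1" "denominator (Fract a2 q2) = q2"
    using assms by (auto simp: denominator_def quotient_of_Fract_coprime)
  then have "(q1, q2) \<in> denominator_pairs Q"
    using assms(1) unfolding denominator_pairs_def by force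
  then show ?thesis using assms(2) unfolding scaled_denominator_pairs_def by force
qed

lemma positive_Rats_common_denominator:
  fixes x y :: real
  assumes "x \<in> \<rat>" "y \<in> \<rat>" "0 < x" "0 < y"
  obtains i j d :: int where "0 < i" "0 < j" "0 < d" "x = of_int i / of_int d" "y = of_int j / of_int d"
proof -
  obtain a b where x: "0 < b" "x = of_int a / of_int b"
    using assms(1) by (elim Rats_cases') auto
  obtain a' b' where y: "0 < b'" "y = of_int a' / of_int b'"
    using assms(2) by (elim Rats_cases') auto
  have "0 < a" "0 < a'" using assms x y by (auto simp: zero_less_divide_iff)
  then show ?thesis using x y by (intro that[of "a * b'" "a' * b" "b * b'"]) auto
qed

lemma rational_point_in_closure:
  fixes x y t :: real
  assumes "x \<in> \<rat>" "y \<in> \<rat>" "t \<in> \<rat>" and pos: "0 < x" "0 < y" "0 < t" "t < 1"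
    and med: "1 < 2 * x + y + t * x + t * y"
    and cases: "x < y \<and> x + y + t * y < 1 \<or> y < x \<and> 2 * x - y + t * x < 1"
  shows "(x, y) \<in> closure scaled_denominator_pairs"
proof -
  obtain i j d where xy: "0 < i" "0 < j" "0 < d" "x = of_int i / of_int d" "y = of_int j / of_int d"
    using positive_Rats_common_denominator[OF assms(1,2) pos(1,2)] by blast
  obtain m n where t: "0 < m" "0 < n" "t = of_int m / of_int n"
    using positive_Rats_common_denominator[OF assms(3,3) pos(3,3)] by blast
  obtain q1 q2 a1 a2 Q :: "nat \<Rightarrow> int" where det: "\<And>N. q1 N * a2 N - q2 N * a1 N = 1"
    and Q: "\<forall>\<^sub>F N in sequentially. 3 \<le> Q N"
    and lim: "(\<lambda>N. real_of_int (q1 N) / real_of_int (Q N)) \<longlonglongrightarrow> x"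
    "(\<lambda>N. real_of_int (q2 N) / real_of_int (Q N)) \<longlonglongrightarrow> y"
    "(\<lambda>N. real_of_int (a1 N) / real_of_int (Q N)) \<longlonglongrightarrow> t * x"
    "(\<lambda>N. real_of_int (a2 N) / real_of_int (Q N)) \<longlonglongrightarrow> t * y"
    by (rule unimodular_approximation[OF xy(1-3) t(1,2), folded xy(4,5) t(3)]) (rule that)
  \<comment> \<open>All conditions for consecutiveness are linear in the matrix entries and
    \<open>Q N\<close>, so a strict inequality between the scaled limits holds for the integers once
    \<open>N\<close> is large.\<close>
  have ev: "\<forall>\<^sub>F N in sequentially. 0 < A * q1 N + B * q2 N + C * a1 N + D * a2 N + F * Q N"
    if "0 < of_int A * x + of_int B * y + of_int C * (t * x) + of_int D * (t * y) + of_int F"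
    for A B C D F :: int
  proof -
    have "(\<lambda>N. of_int A * (real_of_int (q1 N) / real_of_int (Q N))
        + of_int B * (real_of_int (q2 N) / real_of_int (Q N))
        + of_int C * (real_of_int (a1 N) / real_of_int (Q N))
        + of_int D * (real_of_int (a2 N) / real_of_int (Q N)) + of_int F)
      \<longlonglongrightarrow> of_int A * x + of_int B * y + of_int C * (t * x) + of_int D * (t * y) + of_int F"
      by (intro tendsto_intros lim)
    from order_tendstoD(1)[OF this that] Q show ?thesis
    proof eventually_elim
      case (elim N)
      then have "0 < real_of_int (A * q1 N + B * q2 N + C * a1 N + D * a2 N + F * Q N) / real_of_int (Q N)"
        by (simp add: add_divide_distrib)
      then show ?case using elim by (simp add: zero_less_divide_iff del: of_int_add of_int_mult)
    qed
  qed
  have tx: "0 < t * x" "t * x < x" "0 < t * y" "t * y < y" using pos by auto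
  have mem: "\<forall>\<^sub>F N in sequentially. (real_of_int (q1 N) / real_of_int (Q N),
      real_of_int (q2 N) / real_of_int (Q N)) \<in> scaled_denominator_pairs"
    using cases
  proof
    assume c: "x < y \<and> x + y + t * y < 1"
    then have "t * x < t * y" using pos by simp
    have "\<forall>\<^sub>F N in sequentially. 0 < a1 N" using ev[of 0 0 1 0 0] tx by simp
    moreover have "\<forall>\<^sub>F N in sequentially. a1 N < q1 N" using ev[of 1 0 "-1" 0 0] tx by simp
    moreover have "\<forall>\<^sub>F N in sequentially. a2 N < q2 N" using ev[of 0 1 0 "-1" 0] tx by simp
    moreover have "\<forall>\<^sub>F N in sequentially. q1 N < q2 N" using ev[of "-1" 1 0 0 0] c by simp
    moreover have "\<forall>\<^sub>F N in sequentially. a1 N < a2 N"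
      using ev[of 0 0 "-1" 1 0] \<open>t * x < t * y\<close> by simp
    moreover have "\<forall>\<^sub>F N in sequentially. 0 < - q1 N - q2 N - a2 N + Q N"
      using ev[of "-1" "-1" 0 "-1" 1] c by simp
    moreover have "\<forall>\<^sub>F N in sequentially. 0 < 2 * q1 N + q2 N + a1 N + a2 N - Q N"
      using ev[of 2 1 1 1 "-1"] med by simp
    ultimately show ?thesis using Q
    proof eventually_elim
      case (elim N)
      then have "consecutive_in (SF (Q N)) (Fract (a1 N) (q1 N)) (Fract (a2 N) (q2 N))"
        using det by (intro consecutive_SF_of_less) auto
      then show ?case using elim det by (intro scaled_denominator_pairsI) auto
    qed
  next
    assume c: "y < x \<and> 2 * x - y + t * x < 1"
    then have "t * y < t * x" using pos by simp
    have "\<forall>\<^sub>F N in sequentially. 0 < a2 N" using ev[of 0 0 0 1 0] tx by simp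
    moreover have "\<forall>\<^sub>F N in sequentially. a1 N < q1 N" using ev[of 1 0 "-1" 0 0] tx by simp
    moreover have "\<forall>\<^sub>F N in sequentially. a2 N < q2 N" using ev[of 0 1 0 "-1" 0] tx by simp
    moreover have "\<forall>\<^sub>F N in sequentially. q2 N < q1 N" using ev[of 1 "-1" 0 0 0] c by simp
    moreover have "\<forall>\<^sub>F N in sequentially. a2 N < a1 N"
      using ev[of 0 0 1 "-1" 0] \<open>t * y < t * x\<close> by simp
    moreover have "\<forall>\<^sub>F N in sequentially. 0 < - 2 * q1 N + q2 N - a1 N + Q N"
      using ev[of "-2" 1 "-1" 0 1] c by simp
    moreover have "\<forall>\<^sub>F N in sequentially. 0 < 2 * q1 N + q2 N + a1 N + a2 N - Q N"
      using ev[of 2 1 1 1 "-1"] med by simp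
    ultimately show ?thesis using Q
    proof eventually_elim
      case (elim N)
      then have "consecutive_in (SF (Q N)) (Fract (a1 N) (q1 N)) (Fract (a2 N) (q2 N))"
        using det by (intro consecutive_SF_of_greater) auto
      then show ?case using elim det by (intro scaled_denominator_pairsI) auto
    qed
  qed
  have "\<forall>\<^sub>F N in sequentially. (real_of_int (q1 N) / real_of_int (Q N),
      real_of_int (q2 N) / real_of_int (Q N)) \<in> closure scaled_denominator_pairs"
    using mem by eventually_elim (use closure_subset in blast)
  moreover have "(\<lambda>N. (real_of_int (q1 N) / real_of_int (Q N),
      real_of_int (q2 N) / real_of_int (Q N))) \<longlonglongrightarrow> (x, y)"
    by (intro tendsto_Pair lim)
  ultimately show ?thesis
    by (intro Lim_in_closed_set[OF closed_closure _ trivial_limit_sequentially])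
qed

section \<open>From rational points to the whole region\<close>

lemma rational_slope_between:
  fixes l u :: real
  assumes "l < u" "l < 1" "0 < u"
  obtains t where "t \<in> \<rat>" "0 < t" "t < 1" "l < t" "t < u"
  using Rats_dense_in_real[of "max 0 l" "min 1 u"] assms by auto

text \<open>This is the interior of \<open>region_V\<close> without the diagonal, on which the
  limits do not decide which denominator is larger.\<close>

definition open_region :: "(real \<times> real) set" where
  "open_region = {(x, y). 0 < x \<and> 0 < y \<and> 1 < 3 * x + 2 * y \<and>
     (x < y \<and> x + y < 1 \<or> y < x \<and> 2 * x - y < 1)}"

lemma open_open_region: "open open_region"
  unfolding open_region_def case_prod_beta
  by (intro open_Collect_conj open_Collect_disj open_Collect_less continuous_intros)

lemma rational_open_region_in_closure:
  assumes "(x, y) \<in> open_region" "x \<in> \<rat>" "y \<in> \<rat>"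
  shows "(x, y) \<in> closure scaled_denominator_pairs"
proof -
  have pos: "0 < x" "0 < y" "1 < 3 * x + 2 * y" using assms by (auto simp: open_region_def)
  have "x < y \<and> x + y < 1 \<or> y < x \<and> 2 * x - y < 1" using assms by (auto simp: open_region_def)
  then show ?thesis
  proof
    assume c: "x < y \<and> x + y < 1"
    \<comment> \<open>The mediant condition bounds the slope \<open>t\<close> below and the height
      condition bounds it above; the identity shows that these bounds leave room. The lower bound is
      less than 1 precisely because \<open>1 < 3 * x + 2 * y\<close>.\<close>
    have "(1 - x - y) * (x + y) - (1 - 2 * x - y) * y = x * (1 - x)" by (simp add: algebra_simps)
    also have "\<dots> > 0" using c pos by simp
    finally have "(1 - 2 * x - y) / (x + y) < (1 - x - y) / y"
      using pos by (simp add: divide_simps)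
    moreover have "(1 - 2 * x - y) / (x + y) < 1" "0 < (1 - x - y) / y"
      using pos c by simp_all
    ultimately obtain t where t: "t \<in> \<rat>" "0 < t" "t < 1" "(1 - 2 * x - y) / (x + y) < t" "t < (1 - x - y) / y"
      by (rule rational_slope_between)
    then show ?thesis using pos c assms
      by (intro rational_point_in_closure[of x y t]) (auto simp: field_simps)
  next
    assume c: "y < x \<and> 2 * x - y < 1"
    have "(1 - 2 * x + y) * (x + y) - (1 - 2 * x - y) * x = y * (1 + y)" by (simp add: algebra_simps)
    also have "\<dots> > 0" using c pos by simp
    finally have "(1 - 2 * x - y) / (x + y) < (1 - 2 * x + y) / x"
      using pos by (simp add: divide_simps)
    moreover have "(1 - 2 * x - y) / (x + y) < 1" "0 < (1 - 2 * x + y) / x"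
      using pos c by simp_all
    ultimately obtain t where t: "t \<in> \<rat>" "0 < t" "t < 1" "(1 - 2 * x - y) / (x + y) < t" "t < (1 - 2 * x + y) / x"
      by (rule rational_slope_between)
    then show ?thesis using pos c assms
      by (intro rational_point_in_closure[of x y t]) (auto simp: field_simps)
  qed
qed

lemma open_region_subset_closure: "open_region \<subseteq> closure scaled_denominator_pairs"
proof
  fix p assume p: "p \<in> open_region"
  show "p \<in> closure scaled_denominator_pairs"
  proof (rule ccontr)
    assume "p \<notin> closure scaled_denominator_pairs"
    moreover have "open (open_region - closure scaled_denominator_pairs)"
      using open_open_region by (intro open_Diff) auto
    ultimately obtain A B where AB: "open A" "open B" "p \<in> A \<times> B"
      "A \<times> B \<subseteq> open_region - closure scaled_denominator_pairs"
      using p by (elim open_prod_elim[of _ p]) auto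
    then have "A \<inter> \<rat> \<noteq> {}" "B \<inter> \<rat> \<noteq> {}"
      using open_Int_closure_eq_empty[of A "\<rat>"] open_Int_closure_eq_empty[of B "\<rat>"]
      by (auto simp: Rats_closure_real)
    then obtain x y where "x \<in> A" "x \<in> \<rat>" "y \<in> B" "y \<in> \<rat>" by blast
    then show False using AB rational_open_region_in_closure by blast
  qed
qed

text \<open>The diagonal cuts the region into two convex polygons. Moving a point slightly towards
  an interior point of its polygon makes every edge inequality strict.\<close>

lemma region_V_subset_closure_open_region: "region_V \<subseteq> closure open_region"
proof
  fix p assume "p \<in> region_V"
  then obtain x y where p: "p = (x, y)" "0 \<le> x" "x \<le> 1" "0 \<le> y" "y \<le> 1" "1 \<le> 3 * x + 2 * y"
    "2 * x - y \<le> 1" "y \<le> max (1 - x) x" unfolding region_V_def by auto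
  have comb: "0 < (1 - e) * u + e * v" if "0 \<le> u" "0 < v" "0 < e" "e < 1" for u v e :: real
    using that by (simp add: add_nonneg_pos)
  \<comment> \<open>The points (1/5, 1/2) and (1/2, 1/4) are interior to the upper and lower
    polygon. The numbers passed to \<open>comb\<close> below are the values there of the coordinates
    and edge functions.\<close>
  define u v :: real where "u = (if x < y then 1/5 else 1/2)" and "v = (if x < y then 1/2 else 1/4)"
  have mem: "((1 - e) * x + e * u, (1 - e) * y + e * v) \<in> open_region" if e: "0 < e" "e < 1" for e
  proof (cases "x < y")
    case True
    then have "y \<le> 1 - x" using p by auto
    show ?thesis
      using comb[OF _ _ e, of x "1/5"] comb[OF _ _ e, of y "1/2"] comb[OF _ _ e, of "3*x+2*y-1" "3/5"]
        comb[OF _ _ e, of "y - x" "3/10"] comb[OF _ _ e, of "1 - x - y" "3/10"] True p \<open>y \<le> 1 - x\<close>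
      by (simp add: open_region_def u_def v_def algebra_simps)
  next
    case False
    show ?thesis
      using comb[OF _ _ e, of x "1/2"] comb[OF _ _ e, of y "1/4"] comb[OF _ _ e, of "3*x+2*y-1" "1"]
        comb[OF _ _ e, of "x - y" "1/4"] comb[OF _ _ e, of "1 - 2 * x + y" "1/4"] False p
      by (simp add: open_region_def u_def v_def algebra_simps)
  qed
  let ?f = "\<lambda>e. ((1 - e) * x + e * u, (1 - e) * y + e * v)"
  have "\<forall>\<^sub>F e in at_right 0. ?f e \<in> closure open_region"
    using eventually_at_right_real[OF zero_less_one]
    by eventually_elim (use mem closure_subset in auto)
  moreover have "(?f \<longlongrightarrow> ((1 - 0) * x + 0 * u, (1 - 0) * y + 0 * v)) (at_right 0)"
    by (intro tendsto_intros)
  then have "(?f \<longlongrightarrow> p) (at_right 0)" using p by simp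
  ultimately show "p \<in> closure open_region"
    by (intro Lim_in_closed_set[OF closed_closure _ trivial_limit_at_right_real])
qed

theorem theorem1:
  shows "scaled_denominator_pairs \<subseteq> region_V \<and> region_V \<subseteq> closure scaled_denominator_pairs"
  using scaled_denominator_pairs_subset region_V_subset_closure_open_region
    closure_minimal[OF open_region_subset_closure closed_closure] by blast

end
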